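(* Let $p$ be a prime and let $G=UT(4,p)$. Then every maximal clique of the commuting graph $\Gamma(G)$ has order (number of vertices) either $p^{3}$ or $p^{4}$.
   Context: For a prime $p$, $UT(4,p)$ is the group, under matrix multiplication, of all $4\times 4$ upper triangular matrices over the finite field $\mathbb{F}_p$ with all diagonal entries equal to $1$. For a finite non-abelian group $G$, the commuting graph $\Gamma(G)$ has vertex set $G$ (central elements included), two distinct vertices $x,y$ being adjacent if and only if $xy=yx$. A clique is a set of pairwise adjacent vertices; a maximal clique is one not properly contained in another clique. *)

theory Defs
  imports
    "Jordan_Normal_Form.Determinant"
    "Berlekamp_Zassenhaus.Finite_Field"
    "Graph_Theory.Pair_Digraph"
begin

definition UT :: "nat \<Rightarrow> ('a :: comm_ring_1) mat monoid" where
  "UT n =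
     \<lparr>carrier = {A \<in> carrier_mat n n. upper_triangular A \<and> (\<forall>i<n. A $$ (i, i) = 1)},
      mult = (*),
      one = 1\<^sub>m n\<rparr>"

(* A simple graph is represented by its set of ordered pairs of adjacent vertices. *)

definition commuting_graph :: "('a, 'b) monoid_scheme \<Rightarrow> 'a pair_pre_digraph" where
  "commuting_graph G =
     \<lparr>pverts = carrier G,
      parcs = {(x, y). x \<in> carrier G \<and> y \<in> carrier G \<and> x \<noteq> y \<and>
                       x \<otimes>\<^bsub>G\<^esub> y = y \<otimes>\<^bsub>G\<^esub> x}\<rparr>"

definition clique :: "'a pair_pre_digraph \<Rightarrow> 'a set \<Rightarrow> bool" where
  "clique \<Gamma> C \<longleftrightarrow> C \<subseteq> pverts \<Gamma> \<and> (\<forall>x\<in>C. \<forall>y\<in>C. x \<noteq> y \<longrightarrow> (x, y) \<in> parcs \<Gamma>)"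

definition maximal_clique :: "'a pair_pre_digraph \<Rightarrow> 'a set \<Rightarrow> bool" where
  "maximal_clique \<Gamma> C \<longleftrightarrow> clique \<Gamma> C \<and> \<not> (\<exists>D. clique \<Gamma> D \<and> C \<subset> D)"

lemma pair_graph_commuting_graph:
  assumes "finite (carrier G)"
  shows "pair_graph (commuting_graph G)"
proof -
  have "finite (parcs (commuting_graph G))"
    by (rule finite_subset[of _ "carrier G \<times> carrier G"])
       (use assms in \<open>auto simp: commuting_graph_def\<close>)
  then show ?thesis
    using assms
    by unfold_locales
       (auto simp: commuting_graph_def symmetric_def sym_def)
qed

lemma UT_mult_closed:
  assumes "A \<in> carrier (UT n)" and "B \<in> carrier (UT n)"
  shows "A * B \<in> carrier (UT n)"
proof -
  have c: "A \<in> carrier_mat n n" "B \<in> carrier_mat n n"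
    and z: "\<And>i j. j < i \<Longrightarrow> i < n \<Longrightarrow> A $$ (i, j) = 0"
           "\<And>i j. j < i \<Longrightarrow> i < n \<Longrightarrow> B $$ (i, j) = 0"
    and d: "\<And>i. i < n \<Longrightarrow> A $$ (i, i) = 1" "\<And>i. i < n \<Longrightarrow> B $$ (i, i) = 1"
    using assms by (auto simp: UT_def)
  have e: "(A * B) $$ (i, j) = (\<Sum>k<n. A $$ (i, k) * B $$ (k, j))" if "i < n" "j < n" for i j
    using that c by (simp add: scalar_prod_def atLeast0LessThan)
  have "(A * B) $$ (i, j) = 0" if "j < i" "i < n" for i j
  proof -
    have "A $$ (i, k) * B $$ (k, j) = 0" if "k < n" for k
      using that z(1)[of k i] z(2)[of j k] \<open>j < i\<close> \<open>i < n\<close> by (cases "k < i") auto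
    then show ?thesis using that e[of i j] by (simp del: index_mult_mat)
  qed
  moreover have "(A * B) $$ (i, i) = 1" if "i < n" for i
  proof -
    have "A $$ (i, k) * B $$ (k, i) = (if k = i then 1 else 0)" if "k < n" for k
      using that z(1)[of k i] z(2)[of i k] d \<open>i < n\<close> by (cases "k < i"; cases "k = i") auto
    then show ?thesis using that e[of i i] by (simp del: index_mult_mat)
  qed
  ultimately show ?thesis
    using c by (auto simp: UT_def simp del: index_mult_mat(1))
qed

lemma finite_UT: "finite (carrier (UT n :: ('a :: {comm_ring_1, finite}) mat monoid))"
proof -
  let ?g = "\<lambda>A :: 'a mat. \<lambda>ij \<in> {..<n} \<times> {..<n}. A $$ ij"
  have "?g ` carrier_mat n n \<subseteq> ({..<n} \<times> {..<n}) \<rightarrow>\<^sub>E UNIV"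
    by (auto simp: PiE_def extensional_def)
  then have "finite (?g ` carrier_mat n n)"
    by (rule finite_subset) (intro finite_PiE, auto)
  moreover have "inj_on ?g (carrier_mat n n)"
  proof (rule inj_onI)
    fix A B :: "'a mat"
    assume c: "A \<in> carrier_mat n n" "B \<in> carrier_mat n n" and eq: "?g A = ?g B"
    have "A $$ (i, j) = B $$ (i, j)" if "i < n" "j < n" for i j
      using fun_cong[OF eq, of "(i, j)"] that by simp
    then show "A = B" using c by (intro eq_matI) auto
  qed
  ultimately have "finite (carrier_mat n n :: 'a mat set)" by (rule finite_imageD)
  then show ?thesis by (rule finite_subset[rotated]) (auto simp: UT_def)
qed

lemma group_UT: "group (UT n :: ('a :: {field, finite}) mat monoid)"
proof -
  let ?U = "UT n :: 'a mat monoid"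
  have cm: "A \<in> carrier_mat n n" if "A \<in> carrier ?U" for A
    using that by (simp add: UT_def)
  have mult: "A \<otimes>\<^bsub>?U\<^esub> B = A * B" for A B by (simp add: UT_def)
  have one: "\<one>\<^bsub>?U\<^esub> = 1\<^sub>m n" by (simp add: UT_def)
  have one_closed: "1\<^sub>m n \<in> carrier ?U" by (auto simp: UT_def)
  have inv: "\<exists>B\<in>carrier ?U. A * B = 1\<^sub>m n" if A: "A \<in> carrier ?U" for A
  proof -
    note c = cm[OF A]
    have "diag_mat A = replicate n 1"
      using A by (intro nth_equalityI) (auto simp: UT_def diag_mat_def)
    then have "det A = 1"
      using A det_upper_triangular[of A n] by (simp add: UT_def)
    then have adj: "adj_mat A * A = 1\<^sub>m n" "adj_mat A \<in> carrier_mat n n"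
      using adj_mat[OF c] by auto
    have "inj_on ((*) A) (carrier ?U)"
    proof (rule inj_onI)
      fix X Y assume X: "X \<in> carrier ?U" and Y: "Y \<in> carrier ?U" and eq: "A * X = A * Y"
      have "adj_mat A * (A * X) = adj_mat A * (A * Y)" using eq by simp
      then show "X = Y"
        using adj c cm[OF X] cm[OF Y]
        by (simp add: assoc_mult_mat[symmetric, of _ n n _ n _ n])
    qed
    moreover have "(*) A ` carrier ?U \<subseteq> carrier ?U"
      using UT_mult_closed[OF A] by auto
    ultimately have "(*) A ` carrier ?U = carrier ?U"
      using finite_UT endo_inj_surj by blast
    then show ?thesis using one_closed by (metis imageE)
  qed
  have "\<exists>B\<in>carrier ?U. B * A = 1\<^sub>m n" if A: "A \<in> carrier ?U" for A
  proof -
    obtain B where B: "B \<in> carrier ?U" "A * B = 1\<^sub>m n" using inv[OF A] by blast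
    then show ?thesis using mat_mult_left_right_inverse[OF cm[OF A] cm[OF B(1)]] by blast
  qed
  then show ?thesis
    using one_closed UT_mult_closed
    by (intro groupI) (auto simp: mult one left_mult_one_mat[OF cm] assoc_mult_mat[OF cm cm cm])
qed

end

theory Submission
  imports Defs
begin

text \<open>
  Write \<open>X = 1 + N\<close> for \<open>X\<close> in \<open>UT(4, F)\<close>. The superdiagonal entries of \<open>X\<close> are \<open>a, b, c\<close>, the
  second diagonal holds \<open>d, e\<close>, and the corner is \<open>f\<close>. Two elements commute iff their nilpotent
  parts do, and comparing the entries of \<open>N N'\<close> and \<open>N' N\<close> gives
  \<open>a b' = a' b\<close>, \<open>b c' = b' c\<close> and \<open>a e' + d c' = a' e + d' c\<close>.
  So commuting means that three alternating bilinear forms on \<open>F\<^sup>6\<close> vanish, and a maximal clique is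
  a subspace \<open>S\<close> maximal among those isotropic for all three forms; equivalently, \<open>S\<close> equals its own
  centralizer. The corner \<open>f\<close> is always free, and the size of \<open>S\<close> is governed by the pairs \<open>(a, c)\<close>
  occurring in it.

  If all these pairs vanish, the forms vanish identically and \<open>S\<close> is the whole space \<open>a = c = 0\<close>, of
  size \<open>q\<^sup>4\<close>. If two of them are linearly independent, the first two forms force \<open>b = 0\<close>
  throughout, and \<open>S\<close> is spanned by the two elements and the corner: a further element, reduced
  modulo these to \<open>(0,0,0,d,e,0)\<close>, has \<open>(d, e)\<close> killed by the third form, as in a Lagrangian plane
  of a symplectic 4-space. If they span a line, generated by the pair of \<open>v = (a,b,c,d,e,f)\<close>, then
  \<open>(0,0,0,a,c,0)\<close> commutes with \<open>S\<close> and so belongs to it, and \<open>S\<close> is spanned by it, \<open>v\<close> and the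
  corner. In the last two cases \<open>S\<close> has dimension 3 and size \<open>q\<^sup>3\<close>.
\<close>

section \<open>Maximal cliques as self-centralizing sets\<close>

lemma maximal_clique_commuting_graph_mem_iff:
  assumes "maximal_clique (commuting_graph G) C"
  shows "x \<in> C \<longleftrightarrow> x \<in> carrier G \<and> (\<forall>y\<in>C. x \<otimes>\<^bsub>G\<^esub> y = y \<otimes>\<^bsub>G\<^esub> x)"
proof
  have cl: "clique (commuting_graph G) C"
    using assms by (simp add: maximal_clique_def)
  show "x \<in> carrier G \<and> (\<forall>y\<in>C. x \<otimes>\<^bsub>G\<^esub> y = y \<otimes>\<^bsub>G\<^esub> x)" if "x \<in> C"
    using cl that by (fastforce simp: clique_def commuting_graph_def)
  show "x \<in> C" if x: "x \<in> carrier G \<and> (\<forall>y\<in>C. x \<otimes>\<^bsub>G\<^esub> y = y \<otimes>\<^bsub>G\<^esub> x)"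
  proof (rule ccontr)
    assume "x \<notin> C"
    moreover have "clique (commuting_graph G) (insert x C)"
      using cl x by (auto simp: clique_def commuting_graph_def)
    ultimately show False
      using assms unfolding maximal_clique_def by blast
  qed
qed

section \<open>Coordinates on UT(4)\<close>

type_synonym 'a coords = "'a \<times> 'a \<times> 'a \<times> 'a \<times> 'a \<times> 'a"

definition ut_mat :: "'a :: comm_ring_1 coords \<Rightarrow> 'a mat" where
  "ut_mat = (\<lambda>(a, b, c, d, e, f).
     mat 4 4 (\<lambda>(i, j). [[1, a, d, f], [0, 1, b, e], [0, 0, 1, c], [0, 0, 0, 1]] ! i ! j))"

fun commutes :: "'a :: comm_ring_1 coords \<Rightarrow> 'a coords \<Rightarrow> bool" where
  "commutes (a, b, c, d, e, f) (a', b', c', d', e', f') \<longleftrightarrow>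
     a * b' = a' * b \<and> b * c' = b' * c \<and> a * e' + d * c' = a' * e + d' * c"

lemma less_4_cases: "(i :: nat) < 4 \<longleftrightarrow> i = 0 \<or> i = 1 \<or> i = 2 \<or> i = 3"
  by auto

lemma ut_mat_carrier_mat: "ut_mat x \<in> carrier_mat 4 4"
  by (cases x) (simp add: ut_mat_def)

lemma ut_mat_index:
  assumes "i < 4" and "j < 4"
  shows "ut_mat (a, b, c, d, e, f) $$ (i, j) =
    [[1, a, d, f], [0, 1, b, e], [0, 0, 1, c], [0, 0, 0, 1]] ! i ! j"
  using assms by (simp add: ut_mat_def)

lemma bij_betw_ut_mat:
  "bij_betw ut_mat (UNIV :: 'a :: comm_ring_1 coords set) (carrier (UT 4))"
  unfolding bij_betw_def
proof
  show "inj (ut_mat :: 'a coords \<Rightarrow> _)"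
  proof (rule injI)
    fix x y :: "'a coords"
    assume eq: "ut_mat x = ut_mat y"
    obtain a b c d e f where x: "x = (a, b, c, d, e, f)"
      by (cases x) auto
    obtain a' b' c' d' e' f' where y: "y = (a', b', c', d', e', f')"
      by (cases y) auto
    have "ut_mat x $$ (i, j) = ut_mat y $$ (i, j)" for i j
      using eq by simp
    from this[of 0 1] this[of 1 2] this[of 2 3] this[of 0 2] this[of 1 3] this[of 0 3]
    show "x = y"
      by (simp add: x y ut_mat_index)
  qed
  show "range ut_mat = (carrier (UT 4) :: 'a mat set)"
  proof
    show "range ut_mat \<subseteq> (carrier (UT 4) :: 'a mat set)"
    proof
      fix A :: "'a mat"
      assume "A \<in> range ut_mat"
      then obtain a b c d e f where A: "A = ut_mat (a, b, c, d, e, f)"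
        by auto
      have "A \<in> carrier_mat 4 4"
        unfolding A by (rule ut_mat_carrier_mat)
      moreover have "A $$ (i, j) = 0" if "j < i" "i < 4" for i j
        using that less_trans[OF that] unfolding A by (auto simp: ut_mat_index less_4_cases)
      moreover have "A $$ (i, i) = 1" if "i < 4" for i
        using that unfolding A by (auto simp: ut_mat_index less_4_cases)
      ultimately show "A \<in> carrier (UT 4)"
        by (auto simp: UT_def)
    qed
    show "(carrier (UT 4) :: 'a mat set) \<subseteq> range ut_mat"
    proof
      fix A :: "'a mat"
      assume A: "A \<in> carrier (UT 4)"
      let ?x = "(A $$ (0,1), A $$ (1,2), A $$ (2,3), A $$ (0,2), A $$ (1,3), A $$ (0,3))"
      have dim: "A \<in> carrier_mat 4 4" and diag: "\<And>i. i < 4 \<Longrightarrow> A $$ (i, i) = 1"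
        and low: "\<And>i j. j < i \<Longrightarrow> i < 4 \<Longrightarrow> A $$ (i, j) = 0"
        using A by (auto simp: UT_def)
      have entry: "A $$ (i, j) = ut_mat ?x $$ (i, j)" if "i < 4" "j < 4" for i j
        using that unfolding less_4_cases
        by (elim disjE; simp add: ut_mat_index diag low)
      have "A = ut_mat ?x"
      proof (rule eq_matI)
        note dims = carrier_matD[OF dim] carrier_matD[OF ut_mat_carrier_mat[of ?x]]
        show "dim_row A = dim_row (ut_mat ?x)" "dim_col A = dim_col (ut_mat ?x)"
          by (simp_all only: dims)
        show "A $$ (i, j) = ut_mat ?x $$ (i, j)"
          if "i < dim_row (ut_mat ?x)" "j < dim_col (ut_mat ?x)" for i j
          using that unfolding dims by (rule entry)
      qed
      then show "A \<in> range ut_mat"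
        by (rule range_eqI)
    qed
  qed
qed

lemma ut_mat_mult:
  "ut_mat (a, b, c, d, e, f) * ut_mat (a', b', c', d', e', f') =
   ut_mat (a + a', b + b', c + c', d + d' + a * b', e + e' + b * c', f + f' + a * e' + d * c')"
  (is "?A * ?B = ?D")
proof (rule eq_matI)
  have c: "?A \<in> carrier_mat 4 4" "?B \<in> carrier_mat 4 4" "?D \<in> carrier_mat 4 4"
    by (rule ut_mat_carrier_mat)+
  then show "dim_row (?A * ?B) = dim_row ?D" "dim_col (?A * ?B) = dim_col ?D"
    by auto
  fix i j assume "i < dim_row ?D" "j < dim_col ?D"
  then have ij: "i < 4" "j < 4"
    using c by auto
  have "(?A * ?B) $$ (i, j) = (\<Sum>k<4. ?A $$ (i, k) * ?B $$ (k, j))"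
    using ij c by (simp add: scalar_prod_def atLeast0LessThan)
  also have "\<dots> = ?A $$ (i, 0) * ?B $$ (0, j) + ?A $$ (i, 1) * ?B $$ (1, j)
      + ?A $$ (i, 2) * ?B $$ (2, j) + ?A $$ (i, 3) * ?B $$ (3, j)"
  proof -
    have "{..<4 :: nat} = {0, 1, 2, 3}"
      by auto
    then show ?thesis
      by (simp add: add.assoc)
  qed
  also have "\<dots> = ?D $$ (i, j)"
    using ij unfolding less_4_cases
    by (elim disjE; simp add: ut_mat_index algebra_simps)
  finally show "(?A * ?B) $$ (i, j) = ?D $$ (i, j)" .
qed

lemma ut_mat_commute_iff: "ut_mat x * ut_mat y = ut_mat y * ut_mat x \<longleftrightarrow> commutes x y"
proof -
  obtain a b c d e f where x: "x = (a, b, c, d, e, f)"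
    by (cases x) auto
  obtain a' b' c' d' e' f' where y: "y = (a', b', c', d', e', f')"
    by (cases y) auto
  have "inj (ut_mat :: 'a coords \<Rightarrow> _)"
    using bij_betw_ut_mat by (rule bij_betw_imp_inj_on)
  then show ?thesis
    by (auto simp: x y ut_mat_mult inj_eq algebra_simps)
qed

section \<open>Self-centralizing sets of coordinate vectors\<close>

lemma linearly_dependent_pair:
  fixes a c a' c' :: "'a :: field"
  assumes "a \<noteq> 0 \<or> c \<noteq> 0" and "a * c' = a' * c"
  obtains t where "a' = t * a" and "c' = t * c"
proof (cases "a = 0")
  case True
  then show ?thesis
    using assms by (intro that[of "c' / c"]) auto
next
  case False
  then show ?thesis
    using assms by (intro that[of "a' / a"]) (auto simp: field_simps)
qed

text \<open>
  Here \<open>(0,0,0,a,c,0)\<close>, the direction with parameter \<open>s\<close>, is the one that makes the third form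
  vanish against every vector whose pair is a multiple of \<open>(a, c)\<close>.
\<close>
lemma self_centralizing_rank_one:
  fixes S :: "'a :: field coords set"
  assumes S: "\<And>x. x \<in> S \<longleftrightarrow> (\<forall>y\<in>S. commutes x y)"
    and v: "(a, b, c, d, e, f) \<in> S" and ac: "a \<noteq> 0 \<or> c \<noteq> 0"
    and dep: "\<And>a' b' c' d' e' f'. (a', b', c', d', e', f') \<in> S \<Longrightarrow> a * c' = a' * c"
  shows "S = range (\<lambda>(t, s, r). (t * a, t * b, t * c, t * d + s * a, t * e + s * c, r))"
    (is "S = range ?g")
proof
  have comm: "commutes x y" if "x \<in> S" "y \<in> S" for x y
    using S that by blast
  have line: "\<exists>t s. a' = t * a \<and> b' = t * b \<and> c' = t * c \<and> d' = t * d + s * a \<and> e' = t * e + s * c"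
    if x: "(a', b', c', d', e', f') \<in> S" for a' b' c' d' e' f'
  proof -
    obtain t where t: "a' = t * a" "c' = t * c"
      using linearly_dependent_pair[OF ac dep[OF x]] .
    have c1: "a * b' = a' * b" "b * c' = b' * c" "a * e' + d * c' = a' * e + d' * c"
      using comm[OF v x] by auto
    have "a * (b' - t * b) = 0" "c * (b' - t * b) = 0"
      using c1 t by (auto simp: algebra_simps)
    then have b: "b' = t * b"
      using ac by auto
    have "a * (e' - t * e) = (d' - t * d) * c"
      using c1(3) t by (simp add: algebra_simps)
    from linearly_dependent_pair[OF ac this] obtain s
      where "d' - t * d = s * a" "e' - t * e = s * c" .
    then have "d' = t * d + s * a" "e' = t * e + s * c"
      by (simp_all add: diff_eq_eq add.commute)
    then show ?thesis
      using t b by blast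
  qed
  show "S \<subseteq> range ?g"
  proof
    fix x assume "x \<in> S"
    moreover obtain a' b' c' d' e' f' where x: "x = (a', b', c', d', e', f')"
      by (cases x) auto
    ultimately obtain t s where "x = ?g (t, s, f')"
      using line[of a' b' c' d' e' f'] by auto
    then show "x \<in> range ?g"
      by (rule range_eqI)
  qed
  show "range ?g \<subseteq> S"
  proof
    fix x assume "x \<in> range ?g"
    then obtain t s r where x: "x = ?g (t, s, r)"
      by auto
    have "commutes x y" if "y \<in> S" for y
    proof -
      obtain a' b' c' d' e' f' where y: "y = (a', b', c', d', e', f')"
        by (cases y) auto
      then obtain t' s' where "a' = t' * a \<and> b' = t' * b \<and> c' = t' * c \<and>
          d' = t' * d + s' * a \<and> e' = t' * e + s' * c"
        using line \<open>y \<in> S\<close> by blast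
      then show ?thesis
        unfolding x y by (auto simp: algebra_simps)
    qed
    then show "x \<in> S"
      using S by blast
  qed
qed

text \<open>Cramer's rule in dimension two.\<close>
lemma unique_solution_2x2:
  fixes a c a' c' :: "'a :: field"
  assumes "a * c' \<noteq> a' * c"
  shows "x * a + y * c = 0 \<Longrightarrow> x * a' + y * c' = 0 \<Longrightarrow> x = 0 \<and> y = 0"
    and "\<exists>s t. p = s * a + t * a' \<and> r = s * c + t * c'"
proof -
  have det: "a * c' - a' * c \<noteq> 0"
    using assms by simp
  show "x = 0 \<and> y = 0" if 1: "x * a + y * c = 0" and 2: "x * a' + y * c' = 0"
  proof -
    have "x * (a * c' - a' * c) = (x * a + y * c) * c' - (x * a' + y * c') * c"
      by (simp add: algebra_simps)
    moreover have "y * (a * c' - a' * c) = (x * a' + y * c') * a - (x * a + y * c) * a'"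
      by (simp add: algebra_simps)
    ultimately show ?thesis
      using det 1 2 by simp
  qed
  let ?D = "a * c' - a' * c"
  let ?s = "(p * c' - r * a') / ?D" and ?t = "(r * a - p * c) / ?D"
  have "?s * a + ?t * a' = (p * ?D) / ?D" "?s * c + ?t * c' = (r * ?D) / ?D"
    by (simp_all add: add_divide_distrib[symmetric] algebra_simps del: nonzero_mult_div_cancel_right)
  then show "\<exists>s t. p = s * a + t * a' \<and> r = s * c + t * c'"
    using det by (metis nonzero_mult_div_cancel_right)
qed

text \<open>
  Independence of the pairs does all the work: it kills the entry \<open>b\<close>, it allows every vector of
  \<open>S\<close> to be reduced to one with pair \<open>(0, 0)\<close>, and it makes the third form against the two given
  vectors determine \<open>(d, e)\<close>.
\<close>
lemma self_centralizing_rank_two: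
  fixes S :: "'a :: field coords set"
  assumes S: "\<And>x. x \<in> S \<longleftrightarrow> (\<forall>y\<in>S. commutes x y)"
    and u: "(a, b, c, d, e, f) \<in> S" and v: "(a', b', c', d', e', f') \<in> S"
    and indep: "a * c' \<noteq> a' * c"
  shows "S = range (\<lambda>(s, t, r).
    (s * a + t * a', 0, s * c + t * c', s * d + t * d', s * e + t * e', r))" (is "S = range ?g")
proof
  have comm: "commutes x y" if "x \<in> S" "y \<in> S" for x y
    using S that by blast
  have uv: "a * b' = a' * b" "b * c' = b' * c" "a * e' + d * c' = a' * e + d' * c"
    using comm[OF u v] by auto
  have zero: "b'' = 0" if x: "(a'', b'', c'', d'', e'', f'') \<in> S" for a'' b'' c'' d'' e'' f''
  proof -
    have ux: "a * b'' = a'' * b" "b * c'' = b'' * c" and vx: "a' * b'' = a'' * b'" "b' * c'' = b'' * c'"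
      using comm[OF u x] comm[OF v x] by auto
    \<comment> \<open>Since \<open>u\<close> and \<open>v\<close> commute, \<open>b' (a, c) = b (a', c')\<close>, which independence excludes unless
      both coefficients vanish.\<close>
    have "b' * a + (- b) * a' = 0" "b' * c + (- b) * c' = 0"
      using uv by (auto simp: algebra_simps)
    moreover have "a * c' \<noteq> c * a'"
      using indep by (simp add: mult.commute)
    ultimately have "b = 0"
      using unique_solution_2x2(1)[of a c' c a' b' "- b"] by simp
    then have "a * b'' = 0" "c * b'' = 0"
      using ux by (auto simp: mult.commute)
    then show ?thesis
      using indep by auto
  qed
  show "S \<subseteq> range ?g"
  proof
    fix x assume xS: "x \<in> S"
    obtain a1 b1 c1 d1 e1 f1 where x: "x = (a1, b1, c1, d1, e1, f1)"
      by (cases x) auto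
    obtain s t where st: "a1 = s * a + t * a'" "c1 = s * c + t * c'"
      using unique_solution_2x2(2)[OF indep] by blast
    have ux: "a * e1 + d * c1 = a1 * e + d1 * c" and vx: "a' * e1 + d' * c1 = a1 * e' + d1 * c'"
      using comm[OF u xS[unfolded x]] comm[OF v xS[unfolded x]] by auto
    define D E where "D = d1 - s * d - t * d'" and "E = e1 - s * e - t * e'"
    \<comment> \<open>Subtracting \<open>s u + t v\<close> leaves a vector with pair \<open>(0, 0)\<close> that still commutes with \<open>u\<close>
      and \<open>v\<close>, because these commute with each other.\<close>
    have "E * a + (- D) * c = (a * e1 + d * c1 - (a1 * e + d1 * c))
        - t * (a * e' + d * c' - (a' * e + d' * c))"
      unfolding st D_def E_def by (simp add: algebra_simps)
    then have "E * a + (- D) * c = 0"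
      using ux uv(3) by simp
    moreover have "E * a' + (- D) * c' = (a' * e1 + d' * c1 - (a1 * e' + d1 * c'))
        + s * (a * e' + d * c' - (a' * e + d' * c))"
      unfolding st D_def E_def by (simp add: algebra_simps)
    then have "E * a' + (- D) * c' = 0"
      using vx uv(3) by simp
    ultimately have "E = 0" "D = 0"
      using unique_solution_2x2(1)[OF indep, of E "- D"] by auto
    then have "x = ?g (s, t, f1)"
      using zero xS st by (auto simp: x D_def E_def algebra_simps)
    then show "x \<in> range ?g"
      by (rule range_eqI)
  qed
  show "range ?g \<subseteq> S"
  proof
    fix x assume "x \<in> range ?g"
    then obtain s t r where x: "x = ?g (s, t, r)"
      by auto
    have "commutes x y" if "y \<in> S" for y
    proof -
      obtain a1 b1 c1 d1 e1 f1 where y: "y = (a1, b1, c1, d1, e1, f1)"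
        by (cases y) auto
      have "b1 = 0"
        using zero that y by blast
      have uy: "a * e1 + d * c1 = a1 * e + d1 * c" and vy: "a' * e1 + d' * c1 = a1 * e' + d1 * c'"
        using comm[OF u that[unfolded y]] comm[OF v that[unfolded y]] by auto
      have "(s * a + t * a') * e1 + (s * d + t * d') * c1 =
          s * (a * e1 + d * c1) + t * (a' * e1 + d' * c1)"
        by (simp add: algebra_simps)
      also have "\<dots> = a1 * (s * e + t * e') + d1 * (s * c + t * c')"
        unfolding uy vy by (simp add: algebra_simps)
      finally show ?thesis
        using \<open>b1 = 0\<close> by (simp add: x y)
    qed
    then show "x \<in> S"
      using S by blast
  qed
qed

lemma self_centralizing_rank_zero:
  fixes S :: "'a :: field coords set"
  assumes S: "\<And>x. x \<in> S \<longleftrightarrow> (\<forall>y\<in>S. commutes x y)"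
    and zero: "\<And>a b c d e f. (a, b, c, d, e, f) \<in> S \<Longrightarrow> a = 0 \<and> c = 0"
  shows "S = range (\<lambda>(b, d, e, f). (0, b, 0, d, e, f))"
proof
  show "S \<subseteq> range (\<lambda>(b, d, e, f). (0, b, 0, d, e, f))"
  proof
    fix x assume xS: "x \<in> S"
    obtain a b c d e f where x: "x = (a, b, c, d, e, f)"
      by (cases x) auto
    have "x = (\<lambda>(b, d, e, f). (0, b, 0, d, e, f)) (b, d, e, f)"
      using zero xS unfolding x by auto
    then show "x \<in> range (\<lambda>(b, d, e, f). (0, b, 0, d, e, f))"
      by (rule range_eqI)
  qed
  have "commutes (0, b, 0, d, e, f) y" if "y \<in> S" for b d e f y
    using that by (cases y) (auto dest!: zero)
  then have "(0, b, 0, d, e, f) \<in> S" for b d e f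
    using S by blast
  then show "range (\<lambda>(b, d, e, f). (0, b, 0, d, e, f)) \<subseteq> S"
    by auto
qed

lemma card_self_centralizing:
  fixes S :: "'a :: {field, finite} coords set"
  assumes S: "\<And>x. x \<in> S \<longleftrightarrow> (\<forall>y\<in>S. commutes x y)"
  shows "card S = CARD('a) ^ 3 \<or> card S = CARD('a) ^ 4"
proof -
  have card3: "card S = CARD('a) ^ 3" if "S = range g" "inj g" for g :: "'a \<times> 'a \<times> 'a \<Rightarrow> _"
    using that by (simp add: card_image card_cartesian_product power3_eq_cube flip: UNIV_Times_UNIV)
  consider
      (zero) "\<forall>a b c d e f. (a, b, c, d, e, f) \<in> S \<longrightarrow> a = 0 \<and> c = 0"
    | (two) a b c d e f a' b' c' d' e' f' where "(a, b, c, d, e, f) \<in> S"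
        "(a', b', c', d', e', f') \<in> S" "a * c' \<noteq> a' * c"
    | (one) a b c d e f where "(a, b, c, d, e, f) \<in> S" "a \<noteq> 0 \<or> c \<noteq> 0"
        "\<forall>a' b' c' d' e' f'. (a', b', c', d', e', f') \<in> S \<longrightarrow> a * c' = a' * c"
    by metis
  then show ?thesis
  proof cases
    case zero
    then have "S = range (\<lambda>(b, d, e, f). (0, b, 0, d, e, f))"
      using self_centralizing_rank_zero[OF S] by blast
    moreover have "inj (\<lambda>(b, d, e, f). (0 :: 'a, b :: 'a, 0 :: 'a, d :: 'a, e :: 'a, f :: 'a))"
      by (auto simp: inj_def)
    ultimately have "card S = CARD('a \<times> 'a \<times> 'a \<times> 'a)"
      by (simp add: card_image)
    then show ?thesis
      by (simp add: card_cartesian_product power4_eq_xxxx flip: UNIV_Times_UNIV)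
  next
    case (two a b c d e f a' b' c' d' e' f')
    let ?g = "\<lambda>(s, t, r). (s * a + t * a', 0, s * c + t * c', s * d + t * d', s * e + t * e', r)"
    have "s = s1 \<and> t = t1"
      if "s * a + t * a' = s1 * a + t1 * a'" "s * c + t * c' = s1 * c + t1 * c'" for s t s1 t1
    proof -
      have "(s - s1) * a + (t - t1) * a' = 0" "(s - s1) * c + (t - t1) * c' = 0"
        using that by (simp_all add: algebra_simps)
      then show ?thesis
        using unique_solution_2x2(1)[of a c' c a' "s - s1" "t - t1"] two(3)
        by (simp add: mult.commute)
    qed
    then have "inj ?g"
      by (intro injI) auto
    then show ?thesis
      using card3 self_centralizing_rank_two[OF S two] by blast
  next
    case (one a b c d e f)
    let ?g = "\<lambda>(t, s, r). (t * a, t * b, t * c, t * d + s * a, t * e + s * c, r)"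
    have "inj ?g"
      using one(2) by (auto simp: inj_def)
    moreover have "S = range ?g"
      using self_centralizing_rank_one[OF S one(1,2)] one(3) by blast
    ultimately show ?thesis
      using card3 by blast
  qed
qed

theorem theorem4p5:
  fixes p :: nat and C :: "'p::prime_card mod_ring mat set"
  assumes "prime p" and "CARD('p) = p"
    and "maximal_clique (commuting_graph (UT 4)) C"
  shows "card C = p ^ 3 \<or> card C = p ^ 4"
proof -
  define S where "S = ut_mat -` C"
  have inj: "inj (ut_mat :: 'p mod_ring coords \<Rightarrow> _)"
    and range: "range (ut_mat :: 'p mod_ring coords \<Rightarrow> _) = carrier (UT 4)"
    using bij_betw_ut_mat by (auto simp: bij_betw_def)
  have mem: "A \<in> C \<longleftrightarrow> A \<in> carrier (UT 4) \<and> (\<forall>B\<in>C. A * B = B * A)" for A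
    using maximal_clique_commuting_graph_mem_iff[OF assms(3), of A] by (simp add: UT_def)
  have C: "C = ut_mat ` S"
  proof -
    have "C \<subseteq> range ut_mat"
      using mem unfolding range by blast
    then show ?thesis
      unfolding S_def image_vimage_eq by (rule Int_absorb2[symmetric])
  qed
  have "x \<in> S \<longleftrightarrow> (\<forall>y\<in>S. commutes x y)" for x
  proof -
    have "ut_mat x \<in> carrier (UT 4)"
      unfolding range[symmetric] by (rule rangeI)
    then have "x \<in> S \<longleftrightarrow> (\<forall>B\<in>C. ut_mat x * B = B * ut_mat x)"
      using mem[of "ut_mat x"] unfolding S_def vimage_eq by blast
    also have "\<dots> \<longleftrightarrow> (\<forall>y\<in>S. commutes x y)"
      by (simp add: C ut_mat_commute_iff)
    finally show ?thesis .
  qed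
  then have "card S = CARD('p mod_ring) ^ 3 \<or> card S = CARD('p mod_ring) ^ 4"
    by (rule card_self_centralizing)
  moreover have "card C = card S"
    unfolding C by (intro card_image inj_on_subset[OF inj]) simp
  moreover have "CARD('p mod_ring) = p"
    using assms(2) by simp
  ultimately show ?thesis
    by simp
qed

end
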